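(* (i) Let $A$ be an abelian group and $S={}_0A$. Then the group $\mathrm{Aut}_E(S)$ is isomorphic to the semidirect product $\mathrm{Ann}_3(A)\rtimes\mathrm{Aut}(A)$, where $\mathrm{Aut}(A)$ acts on $\mathrm{Ann}_3(A)=\{a\in A\mid 3a=0\}$ by $(g,a)\mapsto g(a)$. (ii) If $S$ is a free elliptic group with $n\ge 1$ generators, then $\mathrm{Aut}_E(S)$ is isomorphic to the subgroup of $GL_n(\mathbb{Z})$ consisting of the invertible integral matrices $(a_{ij})$ such that $a_{11}\equiv 1\pmod 3$ and $a_{i1}\equiv 0\pmod 3$ for all $2\le i\le n$.
   Context: An elliptic group is a set $S$ (possibly empty) with a binary operation $\ast$ satisfying, for all $x,y,z,w\in S$: (EG1) $x\ast y=y\ast x$; (EG2) $x\ast(x\ast y)=y$; (EG3) $x\ast(y\ast(z\ast w))=w\ast(y\ast(z\ast x))$. A morphism of elliptic groups is a map $f$ with $f(x\ast y)=f(x)\ast f(y)$. For an (additive) abelian group $A$ and $c\in A$, ${}_cA$ denotes the elliptic group with underlying set $A$ and operation $x\ast_c y=c-x-y$. $\mathrm{Aut}_E(S)$ is the group of automorphisms of $S$ in the category of elliptic groups; $\mathrm{Aut}(A)$ is the group of automorphisms of the abelian group $A$. A free elliptic group with $n$ generators is the free object on an $n$-element set with respect to the forgetful functor from elliptic groups to sets. *)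

theory Defs
  imports
    "HOL-Algebra.Bij"
    "HOL-Number_Theory.Cong"
    "Jordan_Normal_Form.Matrix"
begin

section \<open>Elliptic groups\<close>

record 'a magma = "'a partial_object" +
  emult :: "['a, 'a] \<Rightarrow> 'a" (infixl \<open>\<ast>\<index>\<close> 70)

locale elliptic_group =
  fixes S (structure)
  assumes e_closed: "\<lbrakk>x \<in> carrier S; y \<in> carrier S\<rbrakk> \<Longrightarrow> x \<ast> y \<in> carrier S"
    and EG1: "\<lbrakk>x \<in> carrier S; y \<in> carrier S\<rbrakk> \<Longrightarrow> x \<ast> y = y \<ast> x"
    and EG2: "\<lbrakk>x \<in> carrier S; y \<in> carrier S\<rbrakk> \<Longrightarrow> x \<ast> (x \<ast> y) = y"
    and EG3: "\<lbrakk>x \<in> carrier S; y \<in> carrier S; z \<in> carrier S; w \<in> carrier S\<rbrakk>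
      \<Longrightarrow> x \<ast> (y \<ast> (z \<ast> w)) = w \<ast> (y \<ast> (z \<ast> x))"

text \<open>Morphisms are taken extensional, so that equality of HOL functions is equality of maps
  on the carrier.\<close>

definition ehom :: "('a, 'm) magma_scheme \<Rightarrow> ('b, 'k) magma_scheme \<Rightarrow> ('a \<Rightarrow> 'b) set"
  where "ehom S T = {f \<in> carrier S \<rightarrow>\<^sub>E carrier T.
    \<forall>x \<in> carrier S. \<forall>y \<in> carrier S. f (x \<ast>\<^bsub>S\<^esub> y) = f x \<ast>\<^bsub>T\<^esub> f y}"

definition EndE :: "('a, 'm) magma_scheme \<Rightarrow> ('a \<Rightarrow> 'a) monoid"
  where "EndE S =
    \<lparr>carrier = ehom S S, monoid.mult = compose (carrier S), one = (\<lambda>x \<in> carrier S. x)\<rparr>"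

definition AutE :: "('a, 'm) magma_scheme \<Rightarrow> ('a \<Rightarrow> 'a) monoid"
  where "AutE S = units_of (EndE S)"

text \<open>The elliptic group \<open>\<^sub>cA\<close> with operation \<open>c - x - y\<close>; abelian groups are written
  multiplicatively, as is usual for \<^const>\<open>comm_group\<close>.\<close>

definition elliptic_of :: "('a, 'm) monoid_scheme \<Rightarrow> 'a \<Rightarrow> 'a magma"
  where "elliptic_of A c =
    \<lparr>carrier = carrier A, emult = (\<lambda>x y. c \<otimes>\<^bsub>A\<^esub> inv\<^bsub>A\<^esub> x \<otimes>\<^bsub>A\<^esub> inv\<^bsub>A\<^esub> y)\<rparr>"

text \<open>\<open>free_elliptic_group S X \<iota>\<close>: the pair \<open>(S, \<iota>)\<close> is a free object on the set \<open>X\<close>.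
  HOL cannot quantify over all types inside a formula, so the test objects \<open>T\<close> are the elliptic
  groups carried by subsets of the type \<open>'b + nat\<close>, where \<open>'b\<close> is the type of \<open>S\<close>. Up to
  isomorphism they include all countable elliptic groups, hence all finitely generated ones, as
  well as \<open>S\<close> itself. Every free object in the unrestricted sense satisfies the predicate; and
  for finite \<open>X\<close> nothing else does, by the usual uniqueness argument for free objects.\<close>

definition free_elliptic_group ::
  "('b, 'm) magma_scheme \<Rightarrow> 'x set \<Rightarrow> ('x \<Rightarrow> 'b) \<Rightarrow> bool"
  where "free_elliptic_group S X \<iota> \<longleftrightarrow>
    elliptic_group S \<and> \<iota> \<in> X \<rightarrow> carrier S \<and>
    (\<forall>T :: ('b + nat) magma. elliptic_group T \<longrightarrow>
      (\<forall>\<phi> \<in> X \<rightarrow> carrier T. \<exists>!f. f \<in> ehom S T \<and> (\<forall>x \<in> X. f (\<iota> x) = \<phi> x)))"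

section \<open>Groups\<close>

definition semidirect_prod ::
  "('n, 'a) monoid_scheme \<Rightarrow> ('h, 'b) monoid_scheme \<Rightarrow> ('h \<Rightarrow> 'n \<Rightarrow> 'n) \<Rightarrow> ('n \<times> 'h) monoid"
  where "semidirect_prod N H \<theta> =
    \<lparr>carrier = carrier N \<times> carrier H,
     monoid.mult = (\<lambda>(a, g) (b, h). (a \<otimes>\<^bsub>N\<^esub> \<theta> g b, g \<otimes>\<^bsub>H\<^esub> h)),
     one = (\<one>\<^bsub>N\<^esub>, \<one>\<^bsub>H\<^esub>)\<rparr>"

definition Ann3 :: "('a, 'm) monoid_scheme \<Rightarrow> 'a set"
  where "Ann3 A = {a \<in> carrier A. a [^]\<^bsub>A\<^esub> (3::nat) = \<one>\<^bsub>A\<^esub>}"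

definition GLZ :: "nat \<Rightarrow> int mat monoid"
  where "GLZ n = units_of (ring_mat TYPE(int) n ())"

text \<open>Matrix indices start at 0, so the first column is column 0.\<close>

definition GLZ_cong3 :: "nat \<Rightarrow> int mat set"
  where "GLZ_cong3 n = {M \<in> carrier (GLZ n).
    [M $$ (0, 0) = 1] (mod 3) \<and> (\<forall>i \<in> {1..<n}. [M $$ (i, 0) = 0] (mod 3))}"

section \<open>The objects above are well defined\<close>

lemma ehomD:
  assumes "f \<in> ehom S T"
  shows "x \<in> carrier S \<Longrightarrow> f x \<in> carrier T" "f \<in> extensional (carrier S)"
    "x \<in> carrier S \<Longrightarrow> y \<in> carrier S \<Longrightarrow> f (x \<ast>\<^bsub>S\<^esub> y) = f x \<ast>\<^bsub>T\<^esub> f y"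
  using assms by (auto simp: ehom_def PiE_iff)

lemma (in elliptic_group) monoid_EndE: "monoid (EndE S)"
proof
  fix f g h assume fgh: "f \<in> carrier (EndE S)" "g \<in> carrier (EndE S)" "h \<in> carrier (EndE S)"
  show "f \<otimes>\<^bsub>EndE S\<^esub> g \<otimes>\<^bsub>EndE S\<^esub> h = f \<otimes>\<^bsub>EndE S\<^esub> (g \<otimes>\<^bsub>EndE S\<^esub> h)"
    using fgh by (auto simp: EndE_def compose_def fun_eq_iff dest: ehomD)
next
  fix f g assume "f \<in> carrier (EndE S)" "g \<in> carrier (EndE S)"
  then show "f \<otimes>\<^bsub>EndE S\<^esub> g \<in> carrier (EndE S)"
    by (auto simp: EndE_def ehom_def compose_def e_closed PiE_iff)
next
  fix f assume f: "f \<in> carrier (EndE S)"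
  show "\<one>\<^bsub>EndE S\<^esub> \<otimes>\<^bsub>EndE S\<^esub> f = f"
    using f by (auto simp: EndE_def ehom_def PiE_def)
  show "f \<otimes>\<^bsub>EndE S\<^esub> \<one>\<^bsub>EndE S\<^esub> = f"
    using f by (auto simp: EndE_def ehom_def PiE_def)
qed (auto simp: EndE_def ehom_def e_closed)

lemma (in elliptic_group) group_AutE: "group (AutE S)"
  unfolding AutE_def by (rule monoid.units_group[OF monoid_EndE])

lemma elliptic_group_elliptic_of:
  fixes A (structure)
  assumes "comm_group A" "c \<in> carrier A"
  shows "elliptic_group (elliptic_of A c)"
proof -
  interpret comm_group A by fact
  have canc: "x \<otimes> (inv x \<otimes> y) = y" "inv x \<otimes> (x \<otimes> y) = y"
    if "x \<in> carrier A" "y \<in> carrier A" for x y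
    using that by (simp_all add: m_assoc[symmetric])
  have canc2: "x \<otimes> (y \<otimes> (c \<otimes> (inv x \<otimes> inv c))) = y"
    if "x \<in> carrier A" "y \<in> carrier A" for x y
  proof -
    have "x \<otimes> (y \<otimes> (c \<otimes> (inv x \<otimes> inv c))) = c \<otimes> (inv c \<otimes> (x \<otimes> (inv x \<otimes> y)))"
      using that assms(2) by (simp add: m_ac)
    with that assms(2) show ?thesis by (simp add: canc)
  qed
  show ?thesis
    using assms(2) by unfold_locales (auto simp: elliptic_of_def inv_mult canc canc2 m_ac)
qed

lemma subgroup_Ann3:
  fixes A (structure)
  assumes "comm_group A"
  shows "subgroup (Ann3 A) A"
proof -
  interpret comm_group A by fact
  show ?thesis
    by (rule subgroupI) (auto simp: Ann3_def nat_pow_distrib nat_pow_inv intro: exI[of _ \<one>])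
qed

lemma group_semidirect_prod:
  assumes "group N" "group H"
    and hom: "\<And>g. g \<in> carrier H \<Longrightarrow> \<theta> g \<in> hom N N"
    and one: "\<And>a. a \<in> carrier N \<Longrightarrow> \<theta> \<one>\<^bsub>H\<^esub> a = a"
    and mult: "\<And>g h a. g \<in> carrier H \<Longrightarrow> h \<in> carrier H \<Longrightarrow> a \<in> carrier N
      \<Longrightarrow> \<theta> (g \<otimes>\<^bsub>H\<^esub> h) a = \<theta> g (\<theta> h a)"
  shows "group (semidirect_prod N H \<theta>)"
proof -
  interpret N: group N by fact
  interpret H: group H by fact
  have closed: "\<theta> g a \<in> carrier N" if "g \<in> carrier H" "a \<in> carrier N" for g a
    using hom that by (auto simp: hom_def)
  have distr: "\<theta> g (a \<otimes>\<^bsub>N\<^esub> b) = \<theta> g a \<otimes>\<^bsub>N\<^esub> \<theta> g b"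
    if "g \<in> carrier H" "a \<in> carrier N" "b \<in> carrier N" for g a b
    using hom that by (auto simp: hom_def)
  show ?thesis
  proof (rule groupI)
    fix p assume "p \<in> carrier (semidirect_prod N H \<theta>)"
    then obtain a g where p: "p = (a, g)" "a \<in> carrier N" "g \<in> carrier H"
      by (auto simp: semidirect_prod_def)
    let ?q = "(\<theta> (inv\<^bsub>H\<^esub> g) (inv\<^bsub>N\<^esub> a), inv\<^bsub>H\<^esub> g)"
    have "\<theta> (inv\<^bsub>H\<^esub> g) (inv\<^bsub>N\<^esub> a) \<otimes>\<^bsub>N\<^esub> \<theta> (inv\<^bsub>H\<^esub> g) a = \<theta> (inv\<^bsub>H\<^esub> g) \<one>\<^bsub>N\<^esub>"
      using p by (simp flip: distr)
    also have "\<dots> = \<one>\<^bsub>N\<^esub>"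
      using hom[of "inv\<^bsub>H\<^esub> g"] p assms(1) by (intro hom_one) auto
    finally show "\<exists>q \<in> carrier (semidirect_prod N H \<theta>).
        q \<otimes>\<^bsub>semidirect_prod N H \<theta>\<^esub> p = \<one>\<^bsub>semidirect_prod N H \<theta>\<^esub>"
      using p closed by (intro bexI[of _ ?q]) (auto simp: semidirect_prod_def)
  qed (auto simp: semidirect_prod_def closed distr mult one N.m_assoc H.m_assoc)
qed

lemma group_Ann3_semidirect_Aut:
  fixes A (structure)
  assumes "comm_group A"
  shows "group (semidirect_prod (A\<lparr>carrier := Ann3 A\<rparr>) (AutoGroup A) (\<lambda>g a. g a))"
proof -
  interpret comm_group A by fact
  show ?thesis
  proof (rule group_semidirect_prod)
    show "group (A\<lparr>carrier := Ann3 A\<rparr>)"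
      by (rule subgroup.subgroup_is_group[OF subgroup_Ann3[OF assms] is_group])
    show "group (AutoGroup A)" by (rule AutoGroup)
  next
    fix g assume "g \<in> carrier (AutoGroup A)"
    then have g: "g \<in> hom A A" by (simp add: AutoGroup_def auto_def)
    then interpret g: group_hom A A g by unfold_locales
    have "g a [^] (3::nat) = \<one>" if "a \<in> Ann3 A" for a
      using that by (simp add: Ann3_def flip: g.hom_nat_pow)
    then show "g \<in> hom (A\<lparr>carrier := Ann3 A\<rparr>) (A\<lparr>carrier := Ann3 A\<rparr>)"
      by (auto simp: hom_def Ann3_def)
  qed (auto simp: AutoGroup_def BijGroup_def auto_def Ann3_def compose_def)
qed

lemma subgroup_GLZ_cong3:
  assumes "n \<ge> 1"
  shows "subgroup (GLZ_cong3 n) (GLZ n)"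
proof -
  let ?R = "ring_mat TYPE(int) n ()"
  interpret R: ring ?R by (rule ring_mat)
  interpret G: group "GLZ n" unfolding GLZ_def by (rule R.units_group)
  have carrier: "M \<in> carrier_mat n n" if "M \<in> carrier (GLZ n)" for M
    using that by (simp add: GLZ_def units_of_def Units_def ring_mat_simps)
  have mult: "M \<otimes>\<^bsub>GLZ n\<^esub> N = M * N" for M N
    by (simp add: GLZ_def units_of_def ring_mat_simps)
  have one: "\<one>\<^bsub>GLZ n\<^esub> = 1\<^sub>m n"
    by (simp add: GLZ_def units_of_def ring_mat_simps)
  have mem: "M \<in> GLZ_cong3 n \<longleftrightarrow> M \<in> carrier (GLZ n) \<and>
      (\<forall>i<n. [M $$ (i, 0) = (if i = 0 then 1 else 0)] (mod 3))" for M
    using assms by (auto simp: GLZ_cong3_def)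
  have col: "[(M * N) $$ (i, 0) = M $$ (i, 0)] (mod 3)"
    if "M \<in> carrier (GLZ n)" "N \<in> GLZ_cong3 n" "i < n" for M N i
  proof -
    have "(M * N) $$ (i, 0) = (\<Sum>k<n. M $$ (i, k) * N $$ (k, 0))"
      using that assms carrier[of M] carrier[of N]
      by (auto simp: mem scalar_prod_def lessThan_atLeast0)
    also have "[\<dots> = (\<Sum>k<n. M $$ (i, k) * (if k = 0 then 1 else 0))] (mod 3)"
      using that by (intro cong_sum cong_mult cong_refl) (auto simp: mem)
    also have "(\<Sum>k<n. M $$ (i, k) * (if k = 0 then 1 else 0)) = M $$ (i, 0)"
      using assms by (simp add: if_distrib cong: if_cong)
    finally show ?thesis .
  qed
  show ?thesis
  proof (rule G.subgroupI)
    have "1\<^sub>m n \<in> GLZ_cong3 n" using G.one_closed assms by (auto simp: mem one)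
    then show "GLZ_cong3 n \<noteq> {}" by auto
  next
    fix M assume M: "M \<in> GLZ_cong3 n"
    let ?N = "inv\<^bsub>GLZ n\<^esub> M"
    have N: "?N \<in> carrier (GLZ n)" "?N * M = 1\<^sub>m n"
      using M G.l_inv[of M] by (auto simp: mem mult one)
    have "[1\<^sub>m n $$ (i, 0) = ?N $$ (i, 0)] (mod 3)" if "i < n" for i
      using col[OF N(1) M that] N(2) by simp
    then show "?N \<in> GLZ_cong3 n"
      using N(1) assms by (auto simp: mem cong_sym_eq)
  next
    fix M N assume "M \<in> GLZ_cong3 n" "N \<in> GLZ_cong3 n"
    then show "M \<otimes>\<^bsub>GLZ n\<^esub> N \<in> GLZ_cong3 n"
      using col[of M N] G.m_closed[of M N] cong_trans unfolding mem mult by blast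
  qed (auto simp: mem)
qed

end

theory Submission
  imports Defs "HOL-Library.Countable"
begin

text \<open>A point \<open>e\<close> of an elliptic group turns it into an abelian group with zero \<open>e\<close> and
  \<open>x + y = e \<ast> (x \<ast> y)\<close>, and then \<open>x \<ast> y = c - x - y\<close> for \<open>c = e \<ast> e\<close>. In terms of abelian
  groups, the morphisms from \<open>\<^sub>cA\<close> to \<open>\<^sub>dB\<close> are the maps \<open>x \<mapsto> b + g x\<close> with \<open>g\<close> a homomorphism
  and \<open>3 b + g c = d\<close>. For \<open>c = d = 0\<close> this is (i). For (ii), take one generator as the origin: the
  free elliptic group is \<open>\<int>\<^sup>n\<close> with \<open>c = e\<^sub>1\<close> and generators \<open>0, e\<^sub>2, \<dots>, e\<^sub>n\<close>, and an endomorphism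
  is determined by its linear part \<open>M\<close>, which can be any matrix with \<open>M e\<^sub>1 \<equiv> e\<^sub>1\<close> modulo 3.\<close>

section \<open>Morphisms of elliptic groups\<close>

text \<open>Lets part (ii) be proved for endomorphism and matrix monoids, where no inverses have to
  be tracked; both groups of (ii) are unit groups of such monoids.\<close>

lemma units_of_iso:
  assumes "monoid M" "monoid N" and \<phi>: "\<phi> \<in> iso M N"
  shows "\<phi> \<in> iso (units_of M) (units_of N)"
proof -
  interpret M: monoid M by fact
  interpret N: monoid N by fact
  have closed: "x \<in> carrier M \<Longrightarrow> \<phi> x \<in> carrier N"
    and mult: "x \<in> carrier M \<Longrightarrow> y \<in> carrier M \<Longrightarrow> \<phi> (x \<otimes>\<^bsub>M\<^esub> y) = \<phi> x \<otimes>\<^bsub>N\<^esub> \<phi> y"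
    and bij: "bij_betw \<phi> (carrier M) (carrier N)" for x y
    using \<phi> by (auto simp: iso_def hom_def)
  have surj: "\<exists>x \<in> carrier M. \<phi> x = y" if "y \<in> carrier N" for y
    using bij that by (metis bij_betw_imp_surj_on imageE)
  have inj: "x = y" if "x \<in> carrier M" "y \<in> carrier M" "\<phi> x = \<phi> y" for x y
    using bij that by (auto simp: bij_betw_def inj_on_def)
  \<comment> \<open>\<open>hom\<close> for monoids says nothing about the neutral element.
    Surjectivity supplies it: multiplying the preimage \<open>u\<close> of one by one and applying
    \<phi> forces \<phi> to send one to one.\<close>
  obtain u where u: "u \<in> carrier M" "\<phi> u = \<one>\<^bsub>N\<^esub>" using surj[of "\<one>\<^bsub>N\<^esub>"] by auto
  have one: "\<phi> \<one>\<^bsub>M\<^esub> = \<one>\<^bsub>N\<^esub>"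
    using mult[of u "\<one>\<^bsub>M\<^esub>"] u closed[of "\<one>\<^bsub>M\<^esub>"] by simp
  have unit: "\<phi> x \<in> Units N \<longleftrightarrow> x \<in> Units M" if x: "x \<in> carrier M" for x
  proof
    assume "x \<in> Units M"
    then obtain y where "y \<in> carrier M" "x \<otimes>\<^bsub>M\<^esub> y = \<one>\<^bsub>M\<^esub>" "y \<otimes>\<^bsub>M\<^esub> x = \<one>\<^bsub>M\<^esub>"
      by (auto simp: Units_def)
    then show "\<phi> x \<in> Units N"
      using x one mult[of x y] mult[of y x] closed by (auto simp: Units_def)
  next
    assume "\<phi> x \<in> Units N"
    then obtain z where z: "z \<in> carrier N" "\<phi> x \<otimes>\<^bsub>N\<^esub> z = \<one>\<^bsub>N\<^esub>" "z \<otimes>\<^bsub>N\<^esub> \<phi> x = \<one>\<^bsub>N\<^esub>"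
      by (auto simp: Units_def)
    obtain y where y: "y \<in> carrier M" "\<phi> y = z" using surj[OF z(1)] by auto
    have "x \<otimes>\<^bsub>M\<^esub> y = \<one>\<^bsub>M\<^esub>" "y \<otimes>\<^bsub>M\<^esub> x = \<one>\<^bsub>M\<^esub>"
      using x y z one mult[of x y] mult[of y x] by (auto intro!: inj)
    then show "x \<in> Units M" using x y by (auto simp: Units_def)
  qed
  have "bij_betw \<phi> (Units M) (Units N)"
  proof (rule bij_betw_imageI)
    show "inj_on \<phi> (Units M)" by (auto simp: inj_on_def intro: inj)
    have "y \<in> \<phi> ` Units M" if y: "y \<in> Units N" for y
    proof -
      obtain x where "x \<in> carrier M" "\<phi> x = y" using surj[of y] y by auto
      then show ?thesis using unit[of x] y by blast
    qed
    then show "\<phi> ` Units M = Units N" using unit by auto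
  qed
  then show ?thesis
    using unit mult by (auto simp: iso_def hom_def units_of_def)
qed

lemma ehom_compose:
  assumes "elliptic_group S" "f \<in> ehom S T" "g \<in> ehom T U"
  shows "compose (carrier S) g f \<in> ehom S U"
  using assms by (auto simp: ehom_def compose_def PiE_iff elliptic_group.e_closed)

text \<open>Needed because rebuilding an elliptic group from its abelian group recovers the
  operation on the carrier only, so the two records may differ elsewhere.\<close>

lemma ehom_cong:
  assumes "carrier S = carrier S'" "carrier T = carrier T'"
    and "\<And>x y. x \<in> carrier S \<Longrightarrow> y \<in> carrier S \<Longrightarrow> x \<ast>\<^bsub>S\<^esub> y = x \<ast>\<^bsub>S'\<^esub> y"
    and "\<And>x y. x \<in> carrier T \<Longrightarrow> y \<in> carrier T \<Longrightarrow> x \<ast>\<^bsub>T\<^esub> y = x \<ast>\<^bsub>T'\<^esub> y"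
  shows "ehom S T = ehom S' T'"
  using assms by (auto simp: ehom_def PiE_iff)

text \<open>Transport of structure along an injection. The freeness predicate only tests objects
  carried by \<open>'b + nat\<close>, so the model on integer vectors and \<open>S\<close> itself
  are copied into that type.\<close>

definition magma_image :: "('a \<Rightarrow> 'b) \<Rightarrow> ('a, 'm) magma_scheme \<Rightarrow> 'b magma"
  where "magma_image j S =
    \<lparr>carrier = j ` carrier S,
     emult = (\<lambda>x y. j (inv_into (carrier S) j x \<ast>\<^bsub>S\<^esub> inv_into (carrier S) j y))\<rparr>"

lemma magma_image:
  assumes "elliptic_group S" and j: "inj_on j (carrier S)"
  shows elliptic_group_magma_image: "elliptic_group (magma_image j S)"
    and restrict_ehom_magma_image: "restrict j (carrier S) \<in> ehom S (magma_image j S)"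
proof -
  interpret elliptic_group S by fact
  show "elliptic_group (magma_image j S)"
    using j
    by unfold_locales (auto simp: magma_image_def e_closed EG2 intro!: arg_cong[of _ _ j] intro: EG1 EG3)
  show "restrict j (carrier S) \<in> ehom S (magma_image j S)"
    using j by (auto simp: ehom_def magma_image_def e_closed)
qed

section \<open>The abelian group at a chosen point, and morphisms as affine maps\<close>

definition base_group :: "('a, 'm) magma_scheme \<Rightarrow> 'a \<Rightarrow> 'a monoid"
  where "base_group S e =
    \<lparr>carrier = carrier S, monoid.mult = (\<lambda>x y. e \<ast>\<^bsub>S\<^esub> (x \<ast>\<^bsub>S\<^esub> y)), one = e\<rparr>"

context elliptic_group
begin

text \<open>EG3 exchanges the outer arguments in \<open>z \<ast> (e \<ast> (x \<ast> y))\<close>,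
  which says (x + y) + z = (x + z) + y; with commutativity this is associativity. For inverses, EG2
  gives \<open>x \<ast> (x \<ast> (e \<ast> e)) = e \<ast> e\<close>, and one more
  \<open>e \<ast>\<close> turns this into \<open>e\<close>.\<close>

lemma comm_group_base_group:
  assumes e: "e \<in> carrier S"
  shows "comm_group (base_group S e)"
    and inv_base_group: "x \<in> carrier S \<Longrightarrow> inv\<^bsub>base_group S e\<^esub> x = e \<ast> e \<ast> x"
proof -
  have swap: "e \<ast> (e \<ast> (x \<ast> y) \<ast> z) = e \<ast> (e \<ast> (x \<ast> z) \<ast> y)"
    if "x \<in> carrier S" "y \<in> carrier S" "z \<in> carrier S" for x y z
    using that e EG3[of z e x y] by (simp add: EG1 e_closed)
  have assoc: "e \<ast> (e \<ast> (x \<ast> y) \<ast> z) = e \<ast> (x \<ast> (e \<ast> (y \<ast> z)))"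
    if "x \<in> carrier S" "y \<in> carrier S" "z \<in> carrier S" for x y z
    using that e swap[of y x z] by (simp add: EG1 e_closed)
  have inv: "e \<ast> (e \<ast> e \<ast> x \<ast> x) = e" if "x \<in> carrier S" for x
  proof -
    have "e \<ast> e \<ast> x \<ast> x = x \<ast> (x \<ast> (e \<ast> e))"
      using that e by (metis EG1 e_closed)
    then show ?thesis using that e by (simp add: EG2 e_closed)
  qed
  show "comm_group (base_group S e)"
  proof (rule comm_groupI)
    fix x assume x: "x \<in> carrier (base_group S e)"
    show "\<exists>y\<in>carrier (base_group S e). y \<otimes>\<^bsub>base_group S e\<^esub> x = \<one>\<^bsub>base_group S e\<^esub>"
      using x e inv[of x] by (intro bexI[of _ "e \<ast> e \<ast> x"]) (auto simp: base_group_def e_closed)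
  next
    fix x y assume "x \<in> carrier (base_group S e)" "y \<in> carrier (base_group S e)"
    then show "x \<otimes>\<^bsub>base_group S e\<^esub> y = y \<otimes>\<^bsub>base_group S e\<^esub> x"
      by (simp add: base_group_def EG1)
  qed (use e assoc in \<open>auto simp: base_group_def e_closed EG2\<close>)
  then interpret G: comm_group "base_group S e" .
  show "inv\<^bsub>base_group S e\<^esub> x = e \<ast> e \<ast> x" if "x \<in> carrier S"
    using that e inv[of x]
    by (intro G.inv_equality) (auto simp: base_group_def e_closed)
qed

text \<open>Write c for \<open>e \<ast> e\<close>. The inverse of z is \<open>c \<ast> z\<close>, so
  c - z is \<open>e \<ast> (c \<ast> (c \<ast> z))\<close>, which is \<open>e \<ast> z\<close> by
  EG2. For z = x + y, that is \<open>e \<ast> (x \<ast> y)\<close>, a second use of EG2 leaves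
  \<open>x \<ast> y\<close>.\<close>

lemma elliptic_of_base_group:
  assumes e: "e \<in> carrier S" and xy: "x \<in> carrier S" "y \<in> carrier S"
  shows "x \<ast>\<^bsub>elliptic_of (base_group S e) (e \<ast> e)\<^esub> y = x \<ast> y"
proof -
  let ?G = "base_group S e"
  interpret G: comm_group ?G by (rule comm_group_base_group[OF e])
  have car: "carrier ?G = carrier S" by (simp add: base_group_def)
  have cl: "e \<ast> e \<in> carrier S" "x \<ast> y \<in> carrier S" "e \<ast> (x \<ast> y) \<in> carrier S"
    using assms by (auto intro: e_closed)
  have "x \<ast>\<^bsub>elliptic_of ?G (e \<ast> e)\<^esub> y = (e \<ast> e) \<otimes>\<^bsub>?G\<^esub> inv\<^bsub>?G\<^esub> (x \<otimes>\<^bsub>?G\<^esub> y)"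
    using assms cl unfolding car[symmetric] by (simp add: elliptic_of_def G.inv_mult G.m_assoc)
  also have "x \<otimes>\<^bsub>?G\<^esub> y = e \<ast> (x \<ast> y)" by (simp add: base_group_def)
  also have "inv\<^bsub>?G\<^esub> \<dots> = e \<ast> e \<ast> (e \<ast> (x \<ast> y))" by (rule inv_base_group[OF e cl(3)])
  also have "(e \<ast> e) \<otimes>\<^bsub>?G\<^esub> \<dots> = e \<ast> (e \<ast> e \<ast> (e \<ast> e \<ast> (e \<ast> (x \<ast> y))))"
    by (simp add: base_group_def)
  also have "\<dots> = x \<ast> y" using e cl by (simp add: EG2)
  finally show ?thesis .
qed

end

text \<open>In additive notation the two sides to compare are b + g c - g x - g y and d - 2 b - g x
  - g y, and these agree when d = 3 b + g c.\<close>

lemma ehom_elliptic_ofI: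
  assumes "comm_group A" "comm_group B" and g: "g \<in> hom A B"
    and c: "c \<in> carrier A" and b: "b \<in> carrier B"
    and d: "b [^]\<^bsub>B\<^esub> (3::nat) \<otimes>\<^bsub>B\<^esub> g c = d"
  shows "(\<lambda>x\<in>carrier A. b \<otimes>\<^bsub>B\<^esub> g x) \<in> ehom (elliptic_of A c) (elliptic_of B d)"
proof -
  interpret A: comm_group A by fact
  interpret B: comm_group B by fact
  interpret g: group_hom A B g using g by unfold_locales
  have d': "d = b \<otimes>\<^bsub>B\<^esub> (b \<otimes>\<^bsub>B\<^esub> (b \<otimes>\<^bsub>B\<^esub> g c))"
    using d b c by (simp add: numeral_3_eq_3 B.m_assoc)
  have "b \<otimes>\<^bsub>B\<^esub> g (c \<otimes>\<^bsub>A\<^esub> inv\<^bsub>A\<^esub> x \<otimes>\<^bsub>A\<^esub> inv\<^bsub>A\<^esub> y)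
      = d \<otimes>\<^bsub>B\<^esub> inv\<^bsub>B\<^esub> (b \<otimes>\<^bsub>B\<^esub> g x) \<otimes>\<^bsub>B\<^esub> inv\<^bsub>B\<^esub> (b \<otimes>\<^bsub>B\<^esub> g y)"
    if "x \<in> carrier A" "y \<in> carrier A" for x y
  proof -
    have canc: "u \<otimes>\<^bsub>B\<^esub> (inv\<^bsub>B\<^esub> u \<otimes>\<^bsub>B\<^esub> v) = v" if "u \<in> carrier B" "v \<in> carrier B" for u v
      using that by (simp flip: B.m_assoc)
    have "d \<otimes>\<^bsub>B\<^esub> inv\<^bsub>B\<^esub> (b \<otimes>\<^bsub>B\<^esub> g x) \<otimes>\<^bsub>B\<^esub> inv\<^bsub>B\<^esub> (b \<otimes>\<^bsub>B\<^esub> g y) =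
      b \<otimes>\<^bsub>B\<^esub> (inv\<^bsub>B\<^esub> b \<otimes>\<^bsub>B\<^esub> (b \<otimes>\<^bsub>B\<^esub> (inv\<^bsub>B\<^esub> b \<otimes>\<^bsub>B\<^esub>
        (b \<otimes>\<^bsub>B\<^esub> (g c \<otimes>\<^bsub>B\<^esub> (inv\<^bsub>B\<^esub> g x \<otimes>\<^bsub>B\<^esub> inv\<^bsub>B\<^esub> g y))))))"
      using that b c by (simp add: d' B.inv_mult B.m_ac)
    then show ?thesis using that b c by (simp add: canc B.m_assoc)
  qed
  then show ?thesis
    using b c by (auto simp: ehom_def elliptic_of_def)
qed

text \<open>Converse of \<open>ehom_elliptic_ofI\<close>. The operation depends on x + y only, so
  comparing the pair (x, y) with (0, x + y) yields f x + f y = b + f (x + y): subtracting b makes f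
  additive. The pair (0, 0) yields f c = d - 2 b, which is the condition on b.\<close>

lemma ehom_elliptic_ofD:
  assumes "comm_group A" "comm_group B" and c: "c \<in> carrier A" and d: "d \<in> carrier B"
    and f: "f \<in> ehom (elliptic_of A c) (elliptic_of B d)"
  defines "b \<equiv> f \<one>\<^bsub>A\<^esub>"
  defines "g \<equiv> \<lambda>x\<in>carrier A. inv\<^bsub>B\<^esub> b \<otimes>\<^bsub>B\<^esub> f x"
  shows "b \<in> carrier B" "g \<in> hom A B" "b [^]\<^bsub>B\<^esub> (3::nat) \<otimes>\<^bsub>B\<^esub> g c = d"
    and "f = (\<lambda>x\<in>carrier A. b \<otimes>\<^bsub>B\<^esub> g x)"
proof -
  interpret A: comm_group A by fact
  interpret B: comm_group B by fact
  have canc: "u \<otimes>\<^bsub>B\<^esub> (inv\<^bsub>B\<^esub> u \<otimes>\<^bsub>B\<^esub> v) = v" "inv\<^bsub>B\<^esub> u \<otimes>\<^bsub>B\<^esub> (u \<otimes>\<^bsub>B\<^esub> v) = v"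
    if "u \<in> carrier B" "v \<in> carrier B" for u v
    using that by (simp_all flip: B.m_assoc)
  have fB: "f x \<in> carrier B" if "x \<in> carrier A" for x
    using f that by (auto simp: ehom_def elliptic_of_def)
  have f_op: "f (c \<otimes>\<^bsub>A\<^esub> inv\<^bsub>A\<^esub> x \<otimes>\<^bsub>A\<^esub> inv\<^bsub>A\<^esub> y) = d \<otimes>\<^bsub>B\<^esub> inv\<^bsub>B\<^esub> f x \<otimes>\<^bsub>B\<^esub> inv\<^bsub>B\<^esub> f y"
    if "x \<in> carrier A" "y \<in> carrier A" for x y
    using f that by (auto simp: ehom_def elliptic_of_def)
  show b: "b \<in> carrier B" using fB by (simp add: b_def)
  show "f = (\<lambda>x\<in>carrier A. b \<otimes>\<^bsub>B\<^esub> g x)"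
    using f b fB by (intro extensionalityI[of _ "carrier A"])
      (auto simp: g_def canc ehom_def elliptic_of_def PiE_iff)
  have "f c = d \<otimes>\<^bsub>B\<^esub> inv\<^bsub>B\<^esub> b \<otimes>\<^bsub>B\<^esub> inv\<^bsub>B\<^esub> b"
    using f_op[of "\<one>\<^bsub>A\<^esub>" "\<one>\<^bsub>A\<^esub>"] c by (simp add: b_def)
  \<comment> \<open>\<open>b'\<close> stands for the inverse of \<open>b\<close>. Keeping it
    arbitrary makes this a pure permutation of factors, arranged so that \<open>canc\<close>
    afterwards removes the three pairs.\<close>
  moreover have "b [^]\<^bsub>B\<^esub> (3::nat) \<otimes>\<^bsub>B\<^esub> (b' \<otimes>\<^bsub>B\<^esub> (d \<otimes>\<^bsub>B\<^esub> b' \<otimes>\<^bsub>B\<^esub> b')) =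
      b \<otimes>\<^bsub>B\<^esub> (b' \<otimes>\<^bsub>B\<^esub> (b \<otimes>\<^bsub>B\<^esub> (b' \<otimes>\<^bsub>B\<^esub> (b \<otimes>\<^bsub>B\<^esub> (b' \<otimes>\<^bsub>B\<^esub> d)))))"
    if "b' \<in> carrier B" for b'
    using that b d by (simp add: numeral_3_eq_3 B.m_ac)
  ultimately show "b [^]\<^bsub>B\<^esub> (3::nat) \<otimes>\<^bsub>B\<^esub> g c = d"
    using b c d by (simp add: g_def canc)
  have f_mult: "f x \<otimes>\<^bsub>B\<^esub> f y = b \<otimes>\<^bsub>B\<^esub> f (x \<otimes>\<^bsub>A\<^esub> y)"
    if xy: "x \<in> carrier A" "y \<in> carrier A" for x y
  proof -
    \<comment> \<open>\<open>x \<ast> y = 0 \<ast> (x + y)\<close>\<close>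
    have "c \<otimes>\<^bsub>A\<^esub> inv\<^bsub>A\<^esub> x \<otimes>\<^bsub>A\<^esub> inv\<^bsub>A\<^esub> y
        = c \<otimes>\<^bsub>A\<^esub> inv\<^bsub>A\<^esub> \<one>\<^bsub>A\<^esub> \<otimes>\<^bsub>A\<^esub> inv\<^bsub>A\<^esub> (x \<otimes>\<^bsub>A\<^esub> y)"
      using xy c by (simp add: A.inv_mult A.m_assoc)
    then have "d \<otimes>\<^bsub>B\<^esub> inv\<^bsub>B\<^esub> (f x \<otimes>\<^bsub>B\<^esub> f y) = d \<otimes>\<^bsub>B\<^esub> inv\<^bsub>B\<^esub> (b \<otimes>\<^bsub>B\<^esub> f (x \<otimes>\<^bsub>A\<^esub> y))"
      using xy b d fB f_op[OF xy] f_op[of "\<one>\<^bsub>A\<^esub>" "x \<otimes>\<^bsub>A\<^esub> y"]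
      by (simp add: b_def B.inv_mult B.m_assoc)
    then show ?thesis
      using xy b d fB by (simp add: inj_on_eq_iff[OF B.inv_inj])
  qed
  show "g \<in> hom A B"
  proof (rule homI)
    fix x y assume xy: "x \<in> carrier A" "y \<in> carrier A"
    have "g x \<otimes>\<^bsub>B\<^esub> g y = inv\<^bsub>B\<^esub> b \<otimes>\<^bsub>B\<^esub> (inv\<^bsub>B\<^esub> b \<otimes>\<^bsub>B\<^esub> (f x \<otimes>\<^bsub>B\<^esub> f y))"
      using xy b fB by (simp add: g_def B.m_ac)
    then show "g (x \<otimes>\<^bsub>A\<^esub> y) = g x \<otimes>\<^bsub>B\<^esub> g y"
      using xy b fB by (simp add: g_def f_mult canc)
  qed (use b fB in \<open>simp add: g_def\<close>)
qed

section \<open>Automorphisms and the semidirect product\<close>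

lemma (in elliptic_group) carrier_AutE:
  "carrier (AutE S) = {f \<in> ehom S S. bij_betw f (carrier S) (carrier S)}"
proof (intro equalityI subsetI)
  fix f assume "f \<in> carrier (AutE S)"
  then obtain h where f: "f \<in> ehom S S" and h: "h \<in> ehom S S"
    and "compose (carrier S) f h = (\<lambda>x\<in>carrier S. x)" "compose (carrier S) h f = (\<lambda>x\<in>carrier S. x)"
    by (auto simp: AutE_def units_of_def Units_def EndE_def)
  then have "\<And>x. x \<in> carrier S \<Longrightarrow> f (h x) = x \<and> h (f x) = x"
    by (metis compose_eq restrict_apply')
  then have "bij_betw f (carrier S) (carrier S)"
    using f h by (intro bij_betw_byWitness[where f' = h]) (auto dest: ehomD)
  then show "f \<in> {f \<in> ehom S S. bij_betw f (carrier S) (carrier S)}" using f by simp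
next
  fix f assume "f \<in> {f \<in> ehom S S. bij_betw f (carrier S) (carrier S)}"
  then have f: "f \<in> ehom S S" and bij: "bij_betw f (carrier S) (carrier S)" by auto
  then have "f \<in> Bij (carrier S)" by (auto simp: Bij_def dest: ehomD)
  moreover define h where "h = (\<lambda>x\<in>carrier S. inv_into (carrier S) f x)"
  ultimately have inv: "compose (carrier S) h f = (\<lambda>x\<in>carrier S. x)"
      "compose (carrier S) f h = (\<lambda>x\<in>carrier S. x)"
    using bij by (auto simp: Bij_compose_restrict_eq compose_id_inv_into bij_betw_def)
  have hf: "h (f x) = x" if "x \<in> carrier S" for x
    using fun_cong[OF inv(1), of x] that by (simp add: compose_def)
  have fh: "f (h x) = x" if "x \<in> carrier S" for x
    using fun_cong[OF inv(2), of x] that by (simp add: compose_def)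
  have hS: "h x \<in> carrier S" if "x \<in> carrier S" for x
    using that bij by (simp add: h_def bij_betw_def inv_into_into)
  have "h (x \<ast> y) = h x \<ast> h y" if "x \<in> carrier S" "y \<in> carrier S" for x y
    using that f hf[of "h x \<ast> h y"] hS fh by (simp add: e_closed ehomD(3)[OF f])
  then have "h \<in> ehom S S" using hS by (auto simp: ehom_def h_def)
  then show "f \<in> carrier (AutE S)"
    using f inv by (auto simp: AutE_def units_of_def Units_def EndE_def)
qed

text \<open>For c = d = 0 the condition on the translation part a is 3 a = 0, independently of the
  linear part. Translations are bijective, so the affine map is bijective exactly when its linear
  part is.\<close>

lemma iso_AutE_elliptic_of_one:
  fixes A (structure)
  assumes "comm_group A"
  shows "(\<lambda>(a, g). \<lambda>x\<in>carrier A. a \<otimes> g x)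
    \<in> iso (semidirect_prod (A\<lparr>carrier := Ann3 A\<rparr>) (AutoGroup A) (\<lambda>g a. g a))
        (AutE (elliptic_of A \<one>))"
proof -
  interpret comm_group A by fact
  let ?S = "elliptic_of A \<one>" and ?P = "Ann3 A \<times> auto A"
  let ?\<phi> = "\<lambda>(a, g). \<lambda>x\<in>carrier A. a \<otimes> g x"
  interpret S: elliptic_group ?S by (rule elliptic_group_elliptic_of) (use assms in auto)
  have car: "carrier ?S = carrier A" by (simp add: elliptic_of_def)
  have auto: "g \<in> hom A A" "bij_betw g (carrier A) (carrier A)" "g \<in> extensional (carrier A)"
    "g \<one> = \<one>" if "g \<in> auto A" for g
    using that hom_one[of g A A] is_group by (auto simp: auto_def Bij_def)
  have closed: "g x \<in> carrier A" if "g \<in> auto A" "x \<in> carrier A" for g x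
    using auto(1)[OF that(1)] that(2) by (auto simp: hom_def)
  have translate: "bij_betw (\<lambda>x. a \<otimes> x) (carrier A) (carrier A)" if "a \<in> carrier A" for a
    using that
    by (intro bij_betw_byWitness[where f' = "\<lambda>x. inv a \<otimes> x"]) (auto simp flip: m_assoc)
  have AutE: "?\<phi> (a, g) \<in> carrier (AutE ?S)" if "a \<in> Ann3 A" "g \<in> auto A" for a g
  proof -
    have a: "a \<in> carrier A" "a [^] (3::nat) = \<one>" using that by (auto simp: Ann3_def)
    have "?\<phi> (a, g) \<in> ehom ?S ?S"
      using ehom_elliptic_ofI[OF assms assms auto(1)[OF that(2)], of \<one> a \<one>] a auto(4)[OF that(2)]
      by simp
    moreover have "bij_betw (?\<phi> (a, g)) (carrier A) (carrier A)"
      using bij_betw_trans[OF auto(2)[OF that(2)] translate[OF a(1)]]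
      by (simp add: comp_def cong: bij_betw_cong)
    ultimately show ?thesis by (simp add: S.carrier_AutE car)
  qed
  have "inj_on ?\<phi> ?P"
  proof (rule inj_onI, clarify)
    fix a g b h assume *: "a \<in> Ann3 A" "g \<in> auto A" "b \<in> Ann3 A" "h \<in> auto A"
      and eq: "(\<lambda>x\<in>carrier A. a \<otimes> g x) = (\<lambda>x\<in>carrier A. b \<otimes> h x)"
    then have ab: "a \<in> carrier A" "b \<in> carrier A" by (auto simp: Ann3_def)
    have eq: "a \<otimes> g x = b \<otimes> h x" if "x \<in> carrier A" for x using fun_cong[OF eq, of x] that by simp
    have "a = b" using eq[of \<one>] * ab by (simp add: auto(4))
    moreover have "g x = h x" if "x \<in> carrier A" for x
      using eq[OF that] that * ab closed by (simp add: \<open>a = b\<close>)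
    then have "g = h" using * auto(3) by (intro extensionalityI[of _ "carrier A"]) auto
    ultimately show "a = b \<and> g = h" by simp
  qed
  moreover have "?\<phi> ` ?P = carrier (AutE ?S)"
  proof (intro equalityI subsetI)
    fix f assume "f \<in> carrier (AutE ?S)"
    then have f: "f \<in> ehom ?S ?S" and bij: "bij_betw f (carrier A) (carrier A)"
      by (auto simp: S.carrier_AutE car)
    define a where "a = f \<one>"
    define g where "g = (\<lambda>x\<in>carrier A. inv a \<otimes> f x)"
    note D = ehom_elliptic_ofD[OF assms assms one_closed one_closed f, folded a_def, folded g_def]
    have "g \<one> = \<one>" using hom_one[OF D(2)] is_group by simp
    then have "a \<in> Ann3 A" using D(1,3) by (simp add: Ann3_def)
    moreover have "bij_betw g (carrier A) (carrier A)"
      using bij_betw_trans[OF bij translate[of "inv a"]] D(1)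
      by (simp add: g_def comp_def cong: bij_betw_cong)
    then have "g \<in> auto A" using D(2) by (auto simp: auto_def Bij_def g_def)
    ultimately show "f \<in> ?\<phi> ` ?P" using D(4) by (intro image_eqI[of _ _ "(a, g)"]) auto
  qed (use AutE in auto)
  ultimately have "bij_betw ?\<phi> ?P (carrier (AutE ?S))" by (rule bij_betw_imageI)
  \<comment> \<open>Composition of affine maps, a + g (b + h x) = (a + g b) + g (h x), is the
    multiplication rule of the semidirect product.\<close>
  moreover have "?\<phi> (a \<otimes> g b, compose (carrier A) g h) = compose (carrier A) (?\<phi> (a, g)) (?\<phi> (b, h))"
    if "a \<in> Ann3 A" "g \<in> auto A" "b \<in> Ann3 A" "h \<in> auto A" for a g b h
    using that closed auto(1)[of g]
    by (auto simp: compose_def Ann3_def fun_eq_iff hom_mult m_assoc)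
  ultimately show ?thesis
    using AutE
    by (auto simp: iso_def hom_def semidirect_prod_def AutoGroup_def BijGroup_def auto_def
        AutE_def units_of_def EndE_def car)
qed

section \<open>The free elliptic group on finitely many generators\<close>

definition int_vec_group :: "nat \<Rightarrow> int vec monoid"
  where "int_vec_group n = \<lparr>carrier = carrier_vec n, monoid.mult = (+), one = 0\<^sub>v n\<rparr>"

lemma comm_group_int_vec_group: "comm_group (int_vec_group n)"
proof (rule comm_groupI)
  fix v assume "v \<in> carrier (int_vec_group n)"
  then show "\<exists>w\<in>carrier (int_vec_group n). w \<otimes>\<^bsub>int_vec_group n\<^esub> v = \<one>\<^bsub>int_vec_group n\<^esub>"
    by (intro bexI[of _ "- v"]) (auto simp: int_vec_group_def)
qed (auto simp: int_vec_group_def comm_add_vec assoc_add_vec)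

lemma inv_int_vec_group: "v \<in> carrier_vec n \<Longrightarrow> inv\<^bsub>int_vec_group n\<^esub> v = - v"
proof -
  interpret comm_group "int_vec_group n" by (rule comm_group_int_vec_group)
  assume "v \<in> carrier_vec n"
  then show ?thesis by (intro inv_equality) (auto simp: int_vec_group_def)
qed

definition free_model :: "nat \<Rightarrow> int vec magma"
  where "free_model n = elliptic_of (int_vec_group n) (unit_vec n 0)"

text \<open>The generator with index 0 is the origin; the basis vector it replaces comes back as the
  product of the origin with itself, \<open>unit_vec n 0\<close>.\<close>

definition free_gen :: "nat \<Rightarrow> nat \<Rightarrow> int vec"
  where "free_gen n i = (if i = 0 then 0\<^sub>v n else unit_vec n i)"

lemma carrier_free_model [simp]: "carrier (free_model n) = carrier_vec n"
  by (simp add: free_model_def elliptic_of_def int_vec_group_def)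

lemma free_gen_closed [simp]: "free_gen n i \<in> carrier_vec n"
  by (simp add: free_gen_def)

lemma free_model_mult:
  "v \<in> carrier_vec n \<Longrightarrow> w \<in> carrier_vec n \<Longrightarrow> v \<ast>\<^bsub>free_model n\<^esub> w = unit_vec n 0 + - v + - w"
  by (simp add: free_model_def elliptic_of_def inv_int_vec_group) (simp add: int_vec_group_def)

lemma elliptic_group_free_model: "elliptic_group (free_model n)"
  unfolding free_model_def
  by (rule elliptic_group_elliptic_of[OF comm_group_int_vec_group]) (simp add: int_vec_group_def)

text \<open>The unit vectors generate the lattice as an abelian group. This serves both the
  uniqueness of morphisms out of the model and the matrix form of additive maps.\<close>

lemma carrier_vec_int_induct [consumes 1, case_names zero unit add uminus]:
  assumes v: "(v :: int vec) \<in> carrier_vec n"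
    and zero: "P (0\<^sub>v n)"
    and unit: "\<And>i. i < n \<Longrightarrow> P (unit_vec n i)"
    and add: "\<And>v w. \<lbrakk>v \<in> carrier_vec n; w \<in> carrier_vec n; P v; P w\<rbrakk> \<Longrightarrow> P (v + w)"
    and uminus: "\<And>v. \<lbrakk>v \<in> carrier_vec n; P v\<rbrakk> \<Longrightarrow> P (- v)"
  shows "P v"
proof -
  have nat: "P (int k \<cdot>\<^sub>v unit_vec n i)" if "i < n" for k i
  proof (induction k)
    case 0
    have "int 0 \<cdot>\<^sub>v unit_vec n i = 0\<^sub>v n" by auto
    then show ?case using zero by simp
  next
    case (Suc k)
    have "int (Suc k) \<cdot>\<^sub>v unit_vec n i = unit_vec n i + int k \<cdot>\<^sub>v unit_vec n i"
      by (auto simp: algebra_simps)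
    then show ?case using add[OF _ _ unit[OF that] Suc] by simp
  qed
  have multiple: "P (k \<cdot>\<^sub>v unit_vec n i)" if "i < n" for k i
  proof (cases "k \<ge> 0")
    case True
    then show ?thesis using nat[OF that, of "nat k"] by simp
  next
    case False
    then obtain m where "k = - int m" by (metis int_cases2 linorder_le_cases of_nat_0_le_iff)
    then have "k \<cdot>\<^sub>v unit_vec n i = - (int m \<cdot>\<^sub>v unit_vec n i)" by auto
    then show ?thesis using uminus[OF _ nat[OF that]] by simp
  qed
  \<comment> \<open>Induction on the number of coordinates kept: \<open>v\<close> is cut off after
    the first \<open>k\<close> entries and the others are 0.\<close>
  have "P (vec n (\<lambda>i. if i < k then v $ i else 0))" if "k \<le> n" for k
    using that
  proof (induction k)
    case 0
    have "vec n (\<lambda>i. if i < 0 then v $ i else 0) = 0\<^sub>v n" by auto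
    then show ?case using zero by simp
  next
    case (Suc k)
    have "vec n (\<lambda>i. if i < Suc k then v $ i else 0)
        = vec n (\<lambda>i. if i < k then v $ i else 0) + v $ k \<cdot>\<^sub>v unit_vec n k"
      using Suc.prems by (auto simp: less_Suc_eq)
    then show ?case using Suc add multiple by simp
  qed
  moreover have "vec n (\<lambda>i. if i < n then v $ i else 0) = v" using v by auto
  ultimately show ?thesis by (metis order_refl)
qed

text \<open>Points where f and h agree are closed under the operation and include the generators.
  That yields all vectors, since with o the origin \<open>unit_vec n 0\<close> is
  \<open>o \<ast> o\<close>, v + w is \<open>o \<ast> (v \<ast> w)\<close>, and - v is
  \<open>unit_vec n 0 \<ast> v\<close>.\<close>

lemma ehom_free_model_eqI:
  assumes "elliptic_group T" and f: "f \<in> ehom (free_model n) T" and h: "h \<in> ehom (free_model n) T"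
    and "n \<ge> 1" and gen: "\<And>i. i < n \<Longrightarrow> f (free_gen n i) = h (free_gen n i)"
  shows "f = h"
proof -
  let ?F = "free_model n"
  have at_zero: "f (0\<^sub>v n) = h (0\<^sub>v n)" using gen[of 0] \<open>n \<ge> 1\<close> by (simp add: free_gen_def)
  have op: "f (v \<ast>\<^bsub>?F\<^esub> w) = h (v \<ast>\<^bsub>?F\<^esub> w)"
    if "v \<in> carrier_vec n" "w \<in> carrier_vec n" "f v = h v" "f w = h w" for v w
    using that by (simp add: ehomD(3)[OF f] ehomD(3)[OF h])
  have unit0: "f (unit_vec n 0) = h (unit_vec n 0)"
    using op[of "0\<^sub>v n" "0\<^sub>v n"] at_zero by (simp add: free_model_mult)
  have "f v = h v" if "v \<in> carrier_vec n" for v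
    using that
  proof (induction rule: carrier_vec_int_induct)
    case zero
    then show ?case by (rule at_zero)
  next
    case (unit i)
    then show ?case using gen[of i] unit0 by (cases "i = 0") (auto simp: free_gen_def)
  next
    case (add v w)
    have "v + w = 0\<^sub>v n \<ast>\<^bsub>?F\<^esub> (v \<ast>\<^bsub>?F\<^esub> w)"
      using add.hyps by (auto simp: free_model_mult)
    then show ?case using add op[of v w] op[of "0\<^sub>v n" "v \<ast>\<^bsub>?F\<^esub> w"] at_zero
      by (simp add: free_model_mult)
  next
    case (uminus v)
    have "- v = unit_vec n 0 \<ast>\<^bsub>?F\<^esub> v"
      using uminus.hyps by (auto simp: free_model_mult)
    then show ?case using uminus op unit0 by simp
  qed
  then show ?thesis
    using f h by (intro extensionalityI[of _ "carrier_vec n"]) (auto dest: ehomD)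
qed

text \<open>Taking the image \<open>s 0\<close> of the origin as zero of the target leaves a linear
  map to be found. It may be prescribed freely on the unit vectors, as they form a basis of the
  lattice.\<close>

lemma (in elliptic_group) ex_ehom_free_model:
  assumes s: "\<And>i. i < n \<Longrightarrow> s i \<in> carrier S" and "n \<ge> 1"
  shows "\<exists>\<Psi> \<in> ehom (free_model n) S. \<forall>i<n. \<Psi> (free_gen n i) = s i"
proof -
  define e where "e = s 0"
  have e: "e \<in> carrier S" using assms by (simp add: e_def)
  define G where "G = base_group S e"
  interpret G: comm_group G unfolding G_def by (rule comm_group_base_group[OF e])
  have car: "carrier G = carrier S" and one: "\<one>\<^bsub>G\<^esub> = e" by (simp_all add: G_def base_group_def)
  \<comment> \<open>The value at index 0 is forced: \<open>unit_vec n 0\<close> is the product of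
    the origin with itself, and the origin goes to \<open>e\<close>.\<close>
  define t where "t i = (if i = 0 then e \<ast> e else s i)" for i
  have t: "t i \<in> carrier G" if "i < n" for i using that s e by (simp add: t_def car e_closed)
  define g where "g v = (\<Otimes>\<^bsub>G\<^esub>i\<in>{..<n}. t i [^]\<^bsub>G\<^esub> (v $ i))" for v :: "int vec"
  have g: "g \<in> hom (int_vec_group n) G"
  proof (rule homI)
    fix v w assume "v \<in> carrier (int_vec_group n)" "w \<in> carrier (int_vec_group n)"
    then have vw: "v \<in> carrier_vec n" "w \<in> carrier_vec n" by (auto simp: int_vec_group_def)
    then have "g (v + w) = (\<Otimes>\<^bsub>G\<^esub>i\<in>{..<n}. t i [^]\<^bsub>G\<^esub> (v $ i) \<otimes>\<^bsub>G\<^esub> t i [^]\<^bsub>G\<^esub> (w $ i))"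
      unfolding g_def using t
      by (intro G.finprod_cong) (auto simp: G.int_pow_mult simp_implies_def simp del: G.finprod_multf)
    also have "\<dots> = g v \<otimes>\<^bsub>G\<^esub> g w"
      using t by (auto simp: g_def intro!: G.finprod_multf)
    finally show "g (v \<otimes>\<^bsub>int_vec_group n\<^esub> w) = g v \<otimes>\<^bsub>G\<^esub> g w" by (simp add: int_vec_group_def)
  qed (use t in \<open>auto simp: g_def\<close>)
  have g_unit: "g (unit_vec n j) = t j" if "j < n" for j
  proof -
    have "g (unit_vec n j) = (\<Otimes>\<^bsub>G\<^esub>i\<in>{..<n}. if j = i then t i else \<one>\<^bsub>G\<^esub>)"
      unfolding g_def using t that by (intro G.finprod_cong) (auto simp: simp_implies_def)
    also have "\<dots> = t j" using t that by (intro G.finprod_singleton) auto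
    finally show ?thesis .
  qed
  have g_zero: "g (0\<^sub>v n) = e"
    using hom_one[OF g] comm_group_int_vec_group
    by (simp add: int_vec_group_def comm_group_def one)
  \<comment> \<open>The translation part is zero; the factor \<open>\<one>\<close> only matches the
    form in \<open>ehom_elliptic_ofI\<close>.\<close>
  let ?\<Psi> = "\<lambda>v\<in>carrier_vec n. \<one>\<^bsub>G\<^esub> \<otimes>\<^bsub>G\<^esub> g v"
  have "?\<Psi> \<in> ehom (free_model n) (elliptic_of G (e \<ast> e))"
    using ehom_elliptic_ofI[OF comm_group_int_vec_group G.comm_group_axioms g, of "unit_vec n 0" "\<one>\<^bsub>G\<^esub>" "e \<ast> e"]
      \<open>n \<ge> 1\<close> g_unit[of 0] t[of 0]
    by (simp add: free_model_def int_vec_group_def t_def)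
  also have "ehom (free_model n) (elliptic_of G (e \<ast> e)) = ehom (free_model n) S"
    using elliptic_of_base_group[OF e, folded G_def]
    by (intro ehom_cong) (auto simp: elliptic_of_def car)
  finally have "?\<Psi> \<in> ehom (free_model n) S" .
  moreover have "?\<Psi> (free_gen n i) = s i" if "i < n" for i
    using that g_zero g_unit[OF that] t[OF that] e car
    by (auto simp: free_gen_def t_def e_def)
  ultimately show ?thesis by blast
qed

text \<open>Uniqueness of free objects, with two test objects. A copy of the model gives a map back
  from \<open>S\<close>, so \<Psi> is injective. A copy of \<open>S\<close> shows that going to the
  model and back fixes \<open>S\<close>, because it fixes the generators, so \<Psi> is
  surjective.\<close>

lemma free_elliptic_group_iso_free_model:
  assumes free: "free_elliptic_group (S :: ('b, 'k) magma_scheme) X \<iota>"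
    and n: "card X = n" "n \<ge> 1"
  obtains \<Psi> where "\<Psi> \<in> ehom (free_model n) S" "bij_betw \<Psi> (carrier_vec n) (carrier S)"
proof -
  let ?F = "free_model n"
  interpret S: elliptic_group S using free by (simp add: free_elliptic_group_def)
  have \<iota>: "\<iota> x \<in> carrier S" if "x \<in> X" for x using free that by (auto simp: free_elliptic_group_def)
  have UP: "\<exists>!f. f \<in> ehom S T \<and> (\<forall>x \<in> X. f (\<iota> x) = \<phi> x)"
    if "elliptic_group T" "\<phi> \<in> X \<rightarrow> carrier T" for T :: "('b + nat) magma" and \<phi>
    using free that by (auto simp: free_elliptic_group_def)
  \<comment> \<open>An infinite set has \<open>card\<close> 0, which \<open>n \<ge> 1\<close>
    excludes.\<close>
  have "finite X" using n by (metis card.infinite not_one_le_zero)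
  then obtain h where h: "bij_betw h {0..<n} X" using ex_bij_betw_nat_finite[of X] n by auto
  have hX: "h i \<in> X" if "i < n" for i using h that by (auto simp: bij_betw_def)
  obtain \<Psi> where \<Psi>: "\<Psi> \<in> ehom ?F S" and \<Psi>_gen: "\<And>i. i < n \<Longrightarrow> \<Psi> (free_gen n i) = \<iota> (h i)"
    using S.ex_ehom_free_model[of n "\<lambda>i. \<iota> (h i)"] hX \<iota> n by auto
  define k where "k = inv_into {0..<n} h"
  have k: "k x < n" "h (k x) = x" if "x \<in> X" for x
    using h that inv_into_into[of x h "{0..<n}"] by (auto simp: k_def bij_betw_def f_inv_into_f)
  have kh: "k (h i) = i" if "i < n" for i
    using h that by (simp add: k_def bij_betw_def)

  \<comment> \<open>Integer vectors are countable: their entry lists are numbered by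
    \<open>to_nat\<close>, which places the model in the \<open>nat\<close> summand.\<close>
  let ?j = "\<lambda>v :: int vec. Inr (to_nat (list_of_vec v)) :: 'b + nat"
  have j: "inj_on ?j (carrier ?F)" by (rule inj_onI) (metis Inr_inject inj_to_nat injD vec_list)
  let ?T = "magma_image ?j ?F"
  note T = elliptic_group_magma_image[OF elliptic_group_free_model j]
  have jhom: "restrict ?j (carrier_vec n) \<in> ehom ?F ?T"
    using restrict_ehom_magma_image[OF elliptic_group_free_model j] by simp
  have "(\<lambda>x. ?j (free_gen n (k x))) \<in> X \<rightarrow> carrier ?T" by (auto simp: magma_image_def)
  from UP[OF T this] obtain f where f: "f \<in> ehom S ?T"
    and f_gen: "\<And>x. x \<in> X \<Longrightarrow> f (\<iota> x) = ?j (free_gen n (k x))" by metis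
  have "compose (carrier ?F) f \<Psi> = restrict ?j (carrier_vec n)"
    by (rule ehom_free_model_eqI[OF T ehom_compose[OF elliptic_group_free_model \<Psi> f] jhom n(2)])
      (simp add: compose_def \<Psi>_gen f_gen hX kh)
  then have f\<Psi>: "f (\<Psi> v) = ?j v" if "v \<in> carrier_vec n" for v
    using that by (auto simp: compose_def fun_eq_iff split: if_splits)
  have inj: "inj_on \<Psi> (carrier_vec n)"
    using inj_onD[OF j] f\<Psi> by (intro inj_onI) (metis carrier_free_model)

  \<comment> \<open>Decodes the copy back into the model, so that \<open>f\<close> followed by
    \<open>j'\<close> is a morphism from \<open>S\<close> to the model.\<close>
  define j' where "j' = (\<lambda>y\<in>carrier ?T. inv_into (carrier ?F) ?j y)"
  have j'j: "j' (?j v) = v" if "v \<in> carrier_vec n" for v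
    using inv_into_f_f[OF j, of v] that by (simp add: j'_def magma_image_def del: inv_into_f_f)
  have j'hom: "j' \<in> ehom ?T ?F"
  proof -
    have "j' (y \<ast>\<^bsub>?T\<^esub> z) = j' y \<ast>\<^bsub>?F\<^esub> j' z" if yz: "y \<in> carrier ?T" "z \<in> carrier ?T" for y z
    proof -
      obtain v w where vw: "v \<in> carrier_vec n" "w \<in> carrier_vec n" "y = ?j v" "z = ?j w"
        using yz by (auto simp: magma_image_def)
      have "y \<ast>\<^bsub>?T\<^esub> z = ?j (v \<ast>\<^bsub>?F\<^esub> w)"
        using ehomD(3)[OF jhom, of v w] elliptic_group.e_closed[OF elliptic_group_free_model, of v n w] vw
        by simp
      then show ?thesis
        using vw j'j elliptic_group.e_closed[OF elliptic_group_free_model, of v n w] by simp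
    qed
    moreover have "j' y \<in> carrier ?F" if "y \<in> carrier ?T" for y
      using that j'j by (auto simp: magma_image_def)
    ultimately show ?thesis by (auto simp: ehom_def j'_def)
  qed
  let ?l = "Inl :: 'b \<Rightarrow> 'b + nat"
  have l: "inj_on ?l (carrier S)" by simp
  let ?U = "magma_image ?l S"
  note U = elliptic_group_magma_image[OF S.elliptic_group_axioms l]
  note lhom = restrict_ehom_magma_image[OF S.elliptic_group_axioms l]
  \<comment> \<open>The round trip from \<open>S\<close> to the model and back, followed by
    \<open>Inl\<close>, since uniqueness is available only for targets inside
    \<open>'b + nat\<close>.\<close>
  let ?r = "compose (carrier S) (restrict ?l (carrier S))
    (compose (carrier S) \<Psi> (compose (carrier S) j' f))"
  have r: "?r \<in> ehom S ?U"
    by (rule ehom_compose[OF S.elliptic_group_axioms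
          ehom_compose[OF S.elliptic_group_axioms
            ehom_compose[OF S.elliptic_group_axioms f j'hom] \<Psi>] lhom])
  have "(\<lambda>x. ?l (\<iota> x)) \<in> X \<rightarrow> carrier ?U" using \<iota> by (auto simp: magma_image_def)
  note ex1 = UP[OF U this]
  have "?r = restrict ?l (carrier S)"
  proof (rule trans[OF the1_equality[OF ex1, symmetric] the1_equality[OF ex1]])
    show "?r \<in> ehom S ?U \<and> (\<forall>x\<in>X. ?r (\<iota> x) = ?l (\<iota> x))"
      using r \<iota> by (auto simp: compose_def f_gen j'j \<Psi>_gen k)
    show "restrict ?l (carrier S) \<in> ehom S ?U \<and> (\<forall>x\<in>X. restrict ?l (carrier S) (\<iota> x) = ?l (\<iota> x))"
      using lhom \<iota> by auto
  qed
  moreover have closed: "j' (f y) \<in> carrier_vec n" "\<Psi> (j' (f y)) \<in> carrier S" if "y \<in> carrier S" for y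
    using that ehomD(1)[OF f] ehomD(1)[OF j'hom] ehomD(1)[OF \<Psi>] by auto
  ultimately have "\<Psi> (j' (f y)) = y" if "y \<in> carrier S" for y
    using that by (auto simp: compose_def fun_eq_iff dest: spec[of _ y])
  then have "carrier S \<subseteq> \<Psi> ` carrier_vec n" using closed by (metis imageI subsetI)
  then have "\<Psi> ` carrier_vec n = carrier S" using ehomD(1)[OF \<Psi>] by auto
  then show thesis using that \<Psi> inj by (simp add: bij_betw_def)
qed

text \<open>Conjugation by \<Psi>. Its inverse \<open>J\<close> is a morphism because applying
  \<Psi> to \<open>J y \<ast> J z\<close> gives \<open>y \<ast> z\<close>.\<close>

lemma EndE_iso:
  assumes "elliptic_group S" "elliptic_group T"
    and \<Psi>: "\<Psi> \<in> ehom S T" and bij: "bij_betw \<Psi> (carrier S) (carrier T)"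
  shows "EndE S \<cong> EndE T"
proof -
  interpret S: elliptic_group S by fact
  interpret T: elliptic_group T by fact
  define J where "J = (\<lambda>y\<in>carrier T. inv_into (carrier S) \<Psi> y)"
  have \<Psi>J: "\<Psi> (J y) = y" "J y \<in> carrier S" if "y \<in> carrier T" for y
    using bij that by (auto simp: J_def bij_betw_def f_inv_into_f inv_into_into)
  have J\<Psi>: "J (\<Psi> x) = x" if "x \<in> carrier S" for x
    using bij that ehomD(1)[OF \<Psi>] by (auto simp: J_def bij_betw_def)
  have "J (y \<ast>\<^bsub>T\<^esub> z) = J y \<ast>\<^bsub>S\<^esub> J z" if "y \<in> carrier T" "z \<in> carrier T" for y z
    using that \<Psi>J J\<Psi>[of "J y \<ast>\<^bsub>S\<^esub> J z"] by (simp add: ehomD(3)[OF \<Psi>] S.e_closed)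
  then have J: "J \<in> ehom T S" using \<Psi>J by (auto simp: ehom_def J_def)
  let ?\<phi> = "\<lambda>f. compose (carrier T) \<Psi> (compose (carrier T) f J)"
  let ?\<psi> = "\<lambda>f. compose (carrier S) J (compose (carrier S) f \<Psi>)"
  have closed: "?\<phi> f \<in> ehom T T" if "f \<in> ehom S S" for f
    by (rule ehom_compose[OF T.elliptic_group_axioms
          ehom_compose[OF T.elliptic_group_axioms J that] \<Psi>])
  have "bij_betw ?\<phi> (ehom S S) (ehom T T)"
  proof (rule bij_betw_byWitness[where f' = ?\<psi>])
    show "\<forall>f\<in>ehom S S. ?\<psi> (?\<phi> f) = f"
    proof
      fix f assume f: "f \<in> ehom S S"
      show "?\<psi> (?\<phi> f) = f"
        using ehomD(1,2)[OF f] ehomD(1)[OF \<Psi>]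
        by (intro extensionalityI[of _ "carrier S"]) (auto simp: compose_def J\<Psi>)
    qed
    show "\<forall>f\<in>ehom T T. ?\<phi> (?\<psi> f) = f"
    proof
      fix f assume f: "f \<in> ehom T T"
      show "?\<phi> (?\<psi> f) = f"
        using ehomD(1,2)[OF f] ehomD(1)[OF J]
        by (intro extensionalityI[of _ "carrier T"]) (auto simp: compose_def \<Psi>J)
    qed
    show "?\<psi> ` ehom T T \<subseteq> ehom S S"
      using ehom_compose[OF S.elliptic_group_axioms
          ehom_compose[OF S.elliptic_group_axioms \<Psi>] J] by blast
  qed (use closed in auto)
  moreover have "?\<phi> (compose (carrier S) f h) = compose (carrier T) (?\<phi> f) (?\<phi> h)"
    if "f \<in> ehom S S" "h \<in> ehom S S" for f h
    using ehomD(1)[OF that(1)] ehomD(1)[OF that(2)] ehomD(1)[OF \<Psi>] ehomD(1)[OF J]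
    by (auto simp: compose_def fun_eq_iff J\<Psi>)
  ultimately have "?\<phi> \<in> iso (EndE S) (EndE T)"
    using closed by (auto simp: iso_def hom_def EndE_def)
  then show ?thesis by (auto simp: is_iso_def)
qed

section \<open>Endomorphisms as integral matrices\<close>

lemma mult_mat_unit_vec:
  fixes M :: "'a :: semiring_1 mat"
  assumes "M \<in> carrier_mat m n" "j < n"
  shows "M *\<^sub>v unit_vec n j = col M j"
  using assms by (intro eq_vecI) (auto simp: scalar_prod_right_unit)

lemma mat_eqI_mult_vec:
  fixes M N :: "'a :: semiring_1 mat"
  assumes "M \<in> carrier_mat m n" "N \<in> carrier_mat m n"
    and "\<And>v. v \<in> carrier_vec n \<Longrightarrow> M *\<^sub>v v = N *\<^sub>v v"
  shows "M = N"
proof (rule mat_col_eqI)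
  fix j assume "j < dim_col N"
  then show "col M j = col N j"
    using assms mult_mat_unit_vec[of M m n j] mult_mat_unit_vec[of N m n j] by auto
qed (use assms in auto)

text \<open>The columns are the images of the unit vectors, and additivity spreads the agreement to
  the whole lattice.\<close>

lemma hom_int_vec_group_matrix:
  assumes g: "g \<in> hom (int_vec_group n) (int_vec_group m)"
  obtains M where "M \<in> carrier_mat m n" "\<And>v. v \<in> carrier_vec n \<Longrightarrow> g v = M *\<^sub>v v"
proof -
  interpret g: group_hom "int_vec_group n" "int_vec_group m" g
    using g comm_group_int_vec_group[of n] comm_group_int_vec_group[of m]
    by (intro group_hom.intro group_hom_axioms.intro) (auto simp: comm_group_def)
  have closed: "g v \<in> carrier_vec m" if "v \<in> carrier_vec n" for v
    using g.hom_closed[of v] that by (simp add: int_vec_group_def)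
  define M where "M = mat m n (\<lambda>(i, j). g (unit_vec n j) $ i)"
  have M: "M \<in> carrier_mat m n" by (simp add: M_def)
  have "g v = M *\<^sub>v v" if "v \<in> carrier_vec n" for v
    using that
  proof (induction rule: carrier_vec_int_induct)
    case zero
    then show ?case using g.hom_one M by (auto simp: int_vec_group_def)
  next
    case (unit i)
    have "col M i = g (unit_vec n i)"
      using unit closed[of "unit_vec n i"] by (auto simp: M_def)
    then show ?case using unit mult_mat_unit_vec[OF M] by simp
  next
    case (add v w)
    then show ?case using g.hom_mult[of v w] M
      by (simp add: int_vec_group_def mult_add_distrib_mat_vec)
  next
    case (uminus v)
    then have "g (- v) = - g v"
      using g.hom_inv[of v] closed[of v] by (simp add: inv_int_vec_group) (simp add: int_vec_group_def inv_int_vec_group)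
    then show ?case using uminus M by auto
  qed
  then show thesis using that M by blast
qed

text \<open>The vector \<open>b\<close> with \<open>3 b + M e\<^sub>1 = e\<^sub>1\<close>; \<open>div\<close> truncates unless \<open>M e\<^sub>1 \<equiv> e\<^sub>1\<close> modulo 3.\<close>

definition shift :: "nat \<Rightarrow> int mat \<Rightarrow> int vec"
  where "shift n M = vec n (\<lambda>i. (unit_vec n 0 $ i - M $$ (i, 0)) div 3)"

text \<open>The translation part is a function of \<open>M\<close>: its triple is prescribed, and
  the lattice has no 3-torsion.\<close>

definition affine :: "nat \<Rightarrow> int mat \<Rightarrow> int vec \<Rightarrow> int vec"
  where "affine n M = (\<lambda>v\<in>carrier_vec n. shift n M + M *\<^sub>v v)"

text \<open>Invertibility is left out on purpose: this monoid matches all endomorphisms of the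
  model, and its units then match the automorphisms.\<close>

definition mat_cong3 :: "nat \<Rightarrow> int mat monoid"
  where "mat_cong3 n =
    \<lparr>carrier = {M \<in> carrier_mat n n.
        \<forall>i<n. [M $$ (i, 0) = (if i = 0 then 1 else 0)] (mod 3)},
     monoid.mult = (*), one = 1\<^sub>m n\<rparr>"

lemma shift_closed [simp]: "shift n M \<in> carrier_vec n"
  by (simp add: shift_def)

lemma pow3_int_vec_group:
  assumes "v \<in> carrier_vec n"
  shows "v [^]\<^bsub>int_vec_group n\<^esub> (3::nat) = 3 \<cdot>\<^sub>v v"
proof -
  have "v [^]\<^bsub>int_vec_group n\<^esub> (3::nat) = 0\<^sub>v n + v + v + v"
    by (simp add: numeral_3_eq_3) (simp add: int_vec_group_def)
  then show ?thesis using assms by auto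
qed

text \<open>Coordinatewise, 3 x + y = z is solvable for an integer x exactly when y and z are
  congruent modulo 3, and then x is the exact quotient.\<close>

lemma triple_shift_iff:
  assumes M: "M \<in> carrier_mat n n" and "n \<ge> 1" and b: "b \<in> carrier_vec n"
  shows "3 \<cdot>\<^sub>v b + M *\<^sub>v unit_vec n 0 = unit_vec n 0 \<longleftrightarrow> M \<in> carrier (mat_cong3 n) \<and> b = shift n M"
proof -
  have *: "3 * x + y = z \<longleftrightarrow> [y = z] (mod 3) \<and> x = (z - y) div 3" for x y z :: int
    by (auto simp: cong_iff_dvd_diff dvd_diff_commute[of 3 y])
  have "3 \<cdot>\<^sub>v b + M *\<^sub>v unit_vec n 0 = unit_vec n 0
      \<longleftrightarrow> (\<forall>i<n. 3 * b $ i + M $$ (i, 0) = (if i = 0 then 1 else 0))"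
    using assms by (auto simp: vec_eq_iff mult_mat_unit_vec[OF M])
  also have "\<dots> \<longleftrightarrow> M \<in> carrier (mat_cong3 n) \<and> b = shift n M"
    using assms unfolding * by (auto simp: vec_eq_iff mat_cong3_def shift_def)
  finally show ?thesis .
qed

lemma affine_ehom:
  assumes "M \<in> carrier (mat_cong3 n)" "n \<ge> 1"
  shows "affine n M \<in> ehom (free_model n) (free_model n)"
proof -
  have M: "M \<in> carrier_mat n n" using assms by (simp add: mat_cong3_def)
  have "(\<lambda>v. M *\<^sub>v v) \<in> hom (int_vec_group n) (int_vec_group n)"
    using M by (intro homI) (auto simp: int_vec_group_def mult_add_distrib_mat_vec)
  moreover have "3 \<cdot>\<^sub>v shift n M + M *\<^sub>v unit_vec n 0 = unit_vec n 0"
    using assms M triple_shift_iff by simp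
  then have "shift n M [^]\<^bsub>int_vec_group n\<^esub> (3::nat) \<otimes>\<^bsub>int_vec_group n\<^esub> (M *\<^sub>v unit_vec n 0) = unit_vec n 0"
    unfolding pow3_int_vec_group[OF shift_closed] by (simp add: int_vec_group_def)
  ultimately show ?thesis
    using ehom_elliptic_ofI[OF comm_group_int_vec_group[of n] comm_group_int_vec_group[of n],
        of "\<lambda>v. M *\<^sub>v v" "unit_vec n 0" "shift n M" "unit_vec n 0"]
    by (simp add: free_model_def affine_def int_vec_group_def)
qed

lemma ehom_free_model_affine:
  assumes f: "f \<in> ehom (free_model n) (free_model n)" and "n \<ge> 1"
  obtains M where "M \<in> carrier (mat_cong3 n)" "f = affine n M"
proof -
  let ?G = "int_vec_group n"
  \<comment> \<open>Written exactly as the linear part in \<open>ehom_elliptic_ofD\<close>, so that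
    its conclusions fold to \<open>g\<close>.\<close>
  define g where "g = (\<lambda>v\<in>carrier ?G. inv\<^bsub>?G\<^esub> f \<one>\<^bsub>?G\<^esub> \<otimes>\<^bsub>?G\<^esub> f v)"
  have e: "unit_vec n 0 \<in> carrier ?G" by (simp add: int_vec_group_def)
  note D = ehom_elliptic_ofD[OF comm_group_int_vec_group comm_group_int_vec_group e e
      f[unfolded free_model_def], folded g_def]
  obtain M where M: "M \<in> carrier_mat n n" and g: "\<And>v. v \<in> carrier_vec n \<Longrightarrow> g v = M *\<^sub>v v"
    using hom_int_vec_group_matrix[OF D(2)] by blast
  have b: "f \<one>\<^bsub>?G\<^esub> \<in> carrier_vec n" using D(1) by (simp add: int_vec_group_def)
  have "3 \<cdot>\<^sub>v f \<one>\<^bsub>?G\<^esub> + M *\<^sub>v unit_vec n 0 = unit_vec n 0"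
    using D(3) pow3_int_vec_group[OF b] g by (simp add: int_vec_group_def)
  then have *: "M \<in> carrier (mat_cong3 n)" "f \<one>\<^bsub>?G\<^esub> = shift n M"
    using triple_shift_iff[OF M \<open>n \<ge> 1\<close> b] by auto
  have "f = affine n M"
    using *(2) by (subst D(4)) (auto simp: affine_def g int_vec_group_def fun_eq_iff restrict_def)
  with *(1) that show thesis by blast
qed

text \<open>The value at 0 is the translation part, and subtracting it leaves the matrix. The vector
  \<open>b\<close> is arbitrary because the translation part of a composite is not yet known to be a
  \<open>shift\<close>.\<close>

lemma linear_part_affine:
  assumes "affine n M = (\<lambda>v\<in>carrier_vec n. b + N *\<^sub>v v)"
    and M: "M \<in> carrier_mat n n" and N: "N \<in> carrier_mat n n" and b: "b \<in> carrier_vec n"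
  shows "M = N"
proof (rule mat_eqI_mult_vec[OF M N])
  have eq: "shift n M + M *\<^sub>v v = b + N *\<^sub>v v" if "v \<in> carrier_vec n" for v
    using fun_cong[OF assms(1), of v] that by (simp add: affine_def)
  have "M *\<^sub>v 0\<^sub>v n = 0\<^sub>v n" "N *\<^sub>v 0\<^sub>v n = 0\<^sub>v n" using M N by auto
  then have "shift n M = b" using eq[of "0\<^sub>v n"] b by simp
  then show "M *\<^sub>v v = N *\<^sub>v v" if "v \<in> carrier_vec n" for v
    using eq[OF that] that M N b by (auto simp: vec_eq_iff)
qed

text \<open>No computation with \<open>div\<close>: the composite is an endomorphism, hence
  \<open>affine n K\<close> for some K in the monoid. Its linear part is visibly
  \<open>M * N\<close>, so K is \<open>M * N\<close>, which gives closure and multiplicativity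
  together.\<close>

lemma affine_mult:
  assumes MN: "M \<in> carrier (mat_cong3 n)" "N \<in> carrier (mat_cong3 n)" and "n \<ge> 1"
  shows mat_cong3_mult_closed: "M * N \<in> carrier (mat_cong3 n)"
    and affine_compose: "affine n (M * N) = compose (carrier_vec n) (affine n M) (affine n N)"
proof -
  have mats: "M \<in> carrier_mat n n" "N \<in> carrier_mat n n" using MN by (auto simp: mat_cong3_def)
  have "compose (carrier_vec n) (affine n M) (affine n N) \<in> ehom (free_model n) (free_model n)"
    using ehom_compose[OF elliptic_group_free_model affine_ehom[OF MN(2)] affine_ehom[OF MN(1)]] \<open>n \<ge> 1\<close>
    by simp
  then obtain K where K: "K \<in> carrier (mat_cong3 n)"
    "compose (carrier_vec n) (affine n M) (affine n N) = affine n K"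
    using ehom_free_model_affine \<open>n \<ge> 1\<close> by blast
  have "affine n K = (\<lambda>v\<in>carrier_vec n. (shift n M + M *\<^sub>v shift n N) + (M * N) *\<^sub>v v)"
    unfolding K(2)[symmetric] using mats
    by (auto simp: compose_def affine_def fun_eq_iff mult_add_distrib_mat_vec
        intro!: assoc_add_vec[symmetric, of _ n])
  then have "K = M * N"
    using mats K(1) by (intro linear_part_affine) (auto simp: mat_cong3_def)
  with K show "M * N \<in> carrier (mat_cong3 n)"
    "affine n (M * N) = compose (carrier_vec n) (affine n M) (affine n N)" by auto
qed

section \<open>The unit group of the matrix monoid, and the two isomorphisms\<close>

lemma monoid_mat_cong3:
  assumes "n \<ge> 1"
  shows "monoid (mat_cong3 n)"
proof (rule monoidI)
  fix M N assume "M \<in> carrier (mat_cong3 n)" "N \<in> carrier (mat_cong3 n)"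
  from mat_cong3_mult_closed[OF this assms]
  show "M \<otimes>\<^bsub>mat_cong3 n\<^esub> N \<in> carrier (mat_cong3 n)" by (simp add: mat_cong3_def)
qed (auto simp: mat_cong3_def)

text \<open>The point is that an inverse in \<open>GLZ n\<close> of a matrix with the congruences
  has them too, which is part of \<open>GLZ_cong3 n\<close> being a subgroup.\<close>

lemma units_of_mat_cong3:
  assumes "n \<ge> 1"
  shows "units_of (mat_cong3 n) = (GLZ n)\<lparr>carrier := GLZ_cong3 n\<rparr>"
proof -
  let ?R = "ring_mat TYPE(int) n ()"
  interpret R: ring ?R by (rule ring_mat)
  interpret GL: group "GLZ n" unfolding GLZ_def by (rule R.units_group)
  interpret H: subgroup "GLZ_cong3 n" "GLZ n" by (rule subgroup_GLZ_cong3[OF assms])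
  have GLZ: "carrier (GLZ n) = {M \<in> carrier_mat n n. \<exists>N\<in>carrier_mat n n. N * M = 1\<^sub>m n \<and> M * N = 1\<^sub>m n}"
    by (simp add: GLZ_def units_of_def Units_def ring_mat_simps)
  have mult: "M \<otimes>\<^bsub>GLZ n\<^esub> N = M * N" and one: "\<one>\<^bsub>GLZ n\<^esub> = 1\<^sub>m n" for M N
    by (simp_all add: GLZ_def units_of_def ring_mat_simps)
  have mult': "M \<otimes>\<^bsub>mat_cong3 n\<^esub> N = M * N" and one': "\<one>\<^bsub>mat_cong3 n\<^esub> = 1\<^sub>m n" for M N
    by (simp_all add: mat_cong3_def)
  have mem: "M \<in> GLZ_cong3 n \<longleftrightarrow> M \<in> carrier (GLZ n) \<and> M \<in> carrier (mat_cong3 n)" for M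
    using assms by (auto simp: GLZ_cong3_def mat_cong3_def GLZ)
  have "Units (mat_cong3 n) = GLZ_cong3 n"
  proof (intro equalityI subsetI)
    fix M assume "M \<in> Units (mat_cong3 n)"
    then show "M \<in> GLZ_cong3 n"
      unfolding mem GLZ by (auto simp: Units_def mat_cong3_def)
  next
    fix M assume M: "M \<in> GLZ_cong3 n"
    then have "inv\<^bsub>GLZ n\<^esub> M \<in> carrier (mat_cong3 n)" "M \<in> carrier (mat_cong3 n)" using mem by auto
    moreover have "inv\<^bsub>GLZ n\<^esub> M * M = 1\<^sub>m n" "M * inv\<^bsub>GLZ n\<^esub> M = 1\<^sub>m n"
      using M GL.l_inv[of M] GL.r_inv[of M] by (auto simp: mult one)
    ultimately show "M \<in> Units (mat_cong3 n)"
      by (auto simp: Units_def mult' one')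
  qed
  then show ?thesis
    by (simp add: units_of_def GLZ_def ring_mat_simps) (simp add: mat_cong3_def)
qed

lemma affine_iso:
  assumes "n \<ge> 1"
  shows "affine n \<in> iso (mat_cong3 n) (EndE (free_model n))"
proof -
  have "inj_on (affine n) (carrier (mat_cong3 n))"
  proof (rule inj_onI)
    fix M N assume "M \<in> carrier (mat_cong3 n)" "N \<in> carrier (mat_cong3 n)" "affine n M = affine n N"
    then show "M = N"
      by (intro linear_part_affine[of n M "shift n N" N]) (auto simp: mat_cong3_def affine_def)
  qed
  moreover have "affine n ` carrier (mat_cong3 n) = ehom (free_model n) (free_model n)"
    using affine_ehom ehom_free_model_affine assms by blast
  moreover have "M \<otimes>\<^bsub>mat_cong3 n\<^esub> N = M * N" for M N by (simp add: mat_cong3_def)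
  ultimately show ?thesis
    using affine_ehom affine_compose assms by (auto simp: iso_def hom_def EndE_def bij_betw_def)
qed

theorem corollary11p2:
  fixes A :: "('a, 'm) monoid_scheme"
    and S :: "('b, 'k) magma_scheme" and X :: "'x set" and \<iota> :: "'x \<Rightarrow> 'b" and n :: nat
  shows "(comm_group A \<longrightarrow>
      AutE (elliptic_of A \<one>\<^bsub>A\<^esub>)
        \<cong> semidirect_prod (A\<lparr>carrier := Ann3 A\<rparr>) (AutoGroup A) (\<lambda>g a. g a))
    \<and> (n \<ge> 1 \<and> card X = n \<and> free_elliptic_group S X \<iota> \<longrightarrow>
      AutE S \<cong> (GLZ n)\<lparr>carrier := GLZ_cong3 n\<rparr>)"
proof (intro conjI impI)
  assume "comm_group A"
  then show "AutE (elliptic_of A \<one>\<^bsub>A\<^esub>)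
      \<cong> semidirect_prod (A\<lparr>carrier := Ann3 A\<rparr>) (AutoGroup A) (\<lambda>g a. g a)"
    using group.iso_sym[OF group_Ann3_semidirect_Aut] is_isoI[OF iso_AutE_elliptic_of_one] by blast
next
  assume *: "n \<ge> 1 \<and> card X = n \<and> free_elliptic_group S X \<iota>"
  then interpret S: elliptic_group S by (simp add: free_elliptic_group_def)
  obtain \<Psi> where "\<Psi> \<in> ehom (free_model n) S" "bij_betw \<Psi> (carrier_vec n) (carrier S)"
    using free_elliptic_group_iso_free_model * by blast
  then obtain \<phi> where "\<phi> \<in> iso (EndE (free_model n)) (EndE S)"
    using EndE_iso[OF elliptic_group_free_model S.elliptic_group_axioms] by (auto simp: is_iso_def)
  from iso_set_trans[OF affine_iso this] have "\<phi> \<circ> affine n \<in> iso (mat_cong3 n) (EndE S)"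
    using * by blast
  \<comment> \<open>The composite is an isomorphism of monoids; taking units on both sides turns it
    into the isomorphism of groups.\<close>
  then have "(GLZ n)\<lparr>carrier := GLZ_cong3 n\<rparr> \<cong> AutE S"
    using units_of_iso[OF monoid_mat_cong3 S.monoid_EndE] units_of_mat_cong3 * is_isoI
    unfolding AutE_def by metis
  moreover have "group ((GLZ n)\<lparr>carrier := GLZ_cong3 n\<rparr>)"
    using * monoid.units_group[OF monoid_mat_cong3] units_of_mat_cong3 by metis
  ultimately show "AutE S \<cong> (GLZ n)\<lparr>carrier := GLZ_cong3 n\<rparr>"
    using group.iso_sym by blast
qed

end
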